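(* Let $T,D,a\in\mathbb{R}$ with $a^2+D^2\neq0$ and let $P:I\to(-\infty,0]$ be the left Poincaré half-map of the system $\dot x=Tx-y$, $\dot y=Dx-a$ associated to $\Sigma=\{x=0\}$. Then $$ \operatorname{sign}\left(y_0+P(y_0)\right)=-\operatorname{sign}(T)\quad\text{for every } y_0\in I\setminus\{0\}. $$ In addition, if $0\in I$ and either $P(0)\neq0$ or $T=0$, then the relationship also holds for $y_0=0$.
   Context: Let $T,D,a\in\mathbb{R}$ with $a^2+D^2\neq0$ (standing assumption) and consider the planar linear system $\dot x=Tx-y$, $\dot y=Dx-a$, with Poincaré section $\Sigma=\{(x,y)\in\mathbb{R}^2:x=0\}$. Left Poincaré half-map $P$: for $y_0\geqslant0$ let $\Phi(t;y_0)=(\Phi_1(t;y_0),\Phi_2(t;y_0))$ be the solution with $\Phi(0;y_0)=(0,y_0)$. If there exists $\tau(y_0)>0$ such that $\Phi_1(\tau(y_0);y_0)=0$ and $\Phi_1(t;y_0)<0$ for every $t\in(0,\tau(y_0))$, put $P(y_0)=\Phi_2(\tau(y_0);y_0)\leqslant0$. If $P(0)$ is not defined by this rule, but for every $\varepsilon>0$ there exist $y_0\in(0,\varepsilon)$ and $y_1\in(-\varepsilon,0)$ with $P(y_0)=y_1$, then $P$ is extended continuously by $P(0)=0$. The domain of $P$ is the interval $I\subset[0,+\infty)$ of all $y_0$ where $P$ is so defined. $\operatorname{sign}$ takes values in $\{-1,0,1\}$, with $\operatorname{sign}(0)=0$. *)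

theory Defs
  imports Complex_Main
begin

definition is_orbit ::
  "real \<Rightarrow> real \<Rightarrow> real \<Rightarrow> real \<Rightarrow> (real \<Rightarrow> real) \<Rightarrow> (real \<Rightarrow> real) \<Rightarrow> bool" where
  "is_orbit T D a y0 x y \<longleftrightarrow>
     x 0 = 0 \<and> y 0 = y0 \<and>
     (\<forall>t. (x has_real_derivative (T * x t - y t)) (at t)) \<and>
     (\<forall>t. (y has_real_derivative (D * x t - a)) (at t))"

text \<open>
  The system is affine, so the orbit through a given point exists for all times and is unique;
  hence the existential quantifier over the orbit below refers to the one solution
  with the given initial value.  The return time is unique as well, because the first
  coordinate is negative on the whole open interval before it.  The inequality
  \<open>y1 \<le> 0\<close> is not imposed: it follows from \<open>x' = - y\<close> at the return time.
\<close>

definition left_return :: "real \<Rightarrow> real \<Rightarrow> real \<Rightarrow> real \<Rightarrow> real \<Rightarrow> bool" where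
  "left_return T D a y0 y1 \<longleftrightarrow>
     (\<exists>x y \<tau>. is_orbit T D a y0 x y \<and> \<tau> > 0 \<and> x \<tau> = 0 \<and>
        (\<forall>t\<in>{0<..<\<tau>}. x t < 0) \<and> y1 = y \<tau>)"

definition extends_to_zero :: "real \<Rightarrow> real \<Rightarrow> real \<Rightarrow> bool" where
  "extends_to_zero T D a \<longleftrightarrow>
     (\<forall>\<epsilon>>0. \<exists>y0\<in>{0<..<\<epsilon>}. \<exists>y1\<in>{-\<epsilon><..<0}. left_return T D a y0 y1)"

definition half_map_domain :: "real \<Rightarrow> real \<Rightarrow> real \<Rightarrow> real set" where
  "half_map_domain T D a =
     {y0. y0 \<ge> 0 \<and> ((\<exists>y1. left_return T D a y0 y1) \<or> (y0 = 0 \<and> extends_to_zero T D a))}"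

text \<open>
  On the domain, the second branch is taken only at \<open>0\<close>, when the orbit through the origin
  does not itself return but the map extends continuously; outside the domain the value is junk.
\<close>

definition half_map :: "real \<Rightarrow> real \<Rightarrow> real \<Rightarrow> real \<Rightarrow> real" where
  "half_map T D a y0 =
     (if \<exists>y1. left_return T D a y0 y1 then (THE y1. left_return T D a y0 y1) else 0)"

end

theory Submission imports Defs begin

text \<open>
  Along a solution, \<open>x'' - T x' + D x = a\<close>, so the energy \<open>x'\<^sup>2 + D x\<^sup>2 - 2 a x\<close> has derivative
  \<open>2 T x'\<^sup>2\<close>. At a point of the section it equals \<open>y\<^sup>2\<close>; hence \<open>P(y0)\<^sup>2 - y0\<^sup>2\<close> has the sign
  of \<open>T\<close>, and the claim follows from \<open>P(y0) \<le> 0 \<le> y0\<close>.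
\<close>

text \<open>A Gronwall estimate: the squared distance of two orbits, damped by an exponential,
  cannot grow and starts at 0. Forward time suffices, since return times are positive.\<close>

lemma is_orbit_unique:
  assumes o1: "is_orbit T D a y0 x y" and o2: "is_orbit T D a y0 x' y'" and "t \<ge> 0"
  shows "x t = x' t" and "y t = y' t"
proof -
  define u where "u = (\<lambda>s. x s - x' s)"
  define v where "v = (\<lambda>s. y s - y' s)"
  \<comment> \<open>The derivative of \<open>u\<^sup>2 + v\<^sup>2\<close> is
    \<open>2 * T * u\<^sup>2 + 2 * (D - 1) * u * v\<close>; together with
    \<open>\<bar>2 * u * v\<bar> \<le> u\<^sup>2 + v\<^sup>2\<close> this gives the growth rate
    \<open>K\<close>.\<close>
  define K where "K = 2 * \<bar>T\<bar> + \<bar>D - 1\<bar>"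
  define W where "W = (\<lambda>s. ((u s)\<^sup>2 + (v s)\<^sup>2) * exp (- K * s))"
  have du: "(u has_real_derivative (T * u s - v s)) (at s)" for s
    using o1 o2 unfolding is_orbit_def u_def v_def
    by (auto intro!: derivative_eq_intros simp: algebra_simps)
  have dv: "(v has_real_derivative (D * u s)) (at s)" for s
    using o1 o2 unfolding is_orbit_def u_def v_def
    by (auto intro!: derivative_eq_intros simp: algebra_simps)
  have dW: "(W has_real_derivative
      (2 * T * (u s)\<^sup>2 + 2 * (D - 1) * (u s * v s) - K * ((u s)\<^sup>2 + (v s)\<^sup>2)) * exp (- K * s)) (at s)" for s
    unfolding W_def
    by (auto intro!: derivative_eq_intros du dv simp: algebra_simps power2_eq_square)
  have "2 * T * (u s)\<^sup>2 + 2 * (D - 1) * (u s * v s) \<le> K * ((u s)\<^sup>2 + (v s)\<^sup>2)" for s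
  proof -
    have "(2 * T) * (u s)\<^sup>2 \<le> (2 * \<bar>T\<bar>) * (u s)\<^sup>2"
      by (rule mult_right_mono) auto
    also have "\<dots> \<le> 2 * \<bar>T\<bar> * ((u s)\<^sup>2 + (v s)\<^sup>2)"
      by (rule mult_left_mono) auto
    finally have "2 * T * (u s)\<^sup>2 \<le> 2 * \<bar>T\<bar> * ((u s)\<^sup>2 + (v s)\<^sup>2)" .
    moreover have "(D - 1) * (2 * (u s * v s)) \<le> \<bar>D - 1\<bar> * \<bar>2 * (u s * v s)\<bar>"
      by (metis abs_ge_self abs_mult)
    moreover have "\<bar>2 * (u s * v s)\<bar> \<le> (u s)\<^sup>2 + (v s)\<^sup>2"
      using sum_squares_bound[of "\<bar>u s\<bar>" "\<bar>v s\<bar>"] by (simp add: abs_mult)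
    then have "\<bar>D - 1\<bar> * \<bar>2 * (u s * v s)\<bar> \<le> \<bar>D - 1\<bar> * ((u s)\<^sup>2 + (v s)\<^sup>2)"
      by (rule mult_left_mono) simp
    ultimately show ?thesis
      unfolding K_def by (simp add: algebra_simps)
  qed
  then have bound: "2 * T * (u s)\<^sup>2 + 2 * (D - 1) * (u s * v s) - K * ((u s)\<^sup>2 + (v s)\<^sup>2) \<le> 0" for s
    by (simp only: diff_le_0_iff_le)
  have "\<exists>w. (W has_real_derivative w) (at s) \<and> w \<le> 0" for s
    using dW[of s] mult_nonpos_nonneg[OF bound[of s] exp_ge_zero] by blast
  then have "W t \<le> W 0"
    by (rule DERIV_nonpos_imp_nonincreasing[OF \<open>t \<ge> 0\<close>])
  moreover have "W 0 = 0"
    using o1 o2 by (simp add: W_def u_def v_def is_orbit_def)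
  ultimately have "(u t)\<^sup>2 + (v t)\<^sup>2 \<le> 0"
    by (simp add: W_def mult_le_0_iff)
  then have "u t = 0 \<and> v t = 0"
    using sum_power2_le_zero_iff by blast
  then show "x t = x' t" and "y t = y' t"
    by (simp_all add: u_def v_def)
qed

text \<open>The two orbits coincide, so at the earlier of two distinct return times the common first
  coordinate would be both zero and negative.\<close>

lemma left_return_unique:
  assumes "left_return T D a y0 y1" and "left_return T D a y0 y1'"
  shows "y1 = y1'"
proof -
  obtain x y \<tau> where o: "is_orbit T D a y0 x y" "\<tau> > 0" "x \<tau> = 0"
      "\<forall>t\<in>{0<..<\<tau>}. x t < 0" "y1 = y \<tau>"
    using assms(1) unfolding left_return_def by blast
  obtain x' y' \<tau>' where o': "is_orbit T D a y0 x' y'" "\<tau>' > 0" "x' \<tau>' = 0"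
      "\<forall>t\<in>{0<..<\<tau>'}. x' t < 0" "y1' = y' \<tau>'"
    using assms(2) unfolding left_return_def by blast
  note eq = is_orbit_unique[OF o(1) o'(1)]
  have "\<not> \<tau> < \<tau>'" "\<not> \<tau>' < \<tau>"
    using o o' eq(1)[of \<tau>] eq(1)[of \<tau>'] by force+
  then have "\<tau> = \<tau>'" by simp
  then show ?thesis
    using o o' eq(2)[of \<tau>] by simp
qed

text \<open>On the section \<open>x' = - y\<close>, so a positive \<open>y1\<close> would make
  \<open>x\<close> decrease to 0 at the return time, hence be positive just before it.\<close>

lemma left_return_nonpos:
  assumes "left_return T D a y0 y1"
  shows "y1 \<le> 0"
proof (rule ccontr)
  assume "\<not> y1 \<le> 0"
  obtain x y \<tau> where o: "is_orbit T D a y0 x y" "\<tau> > 0" "x \<tau> = 0"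
      "\<forall>t\<in>{0<..<\<tau>}. x t < 0" "y1 = y \<tau>"
    using assms unfolding left_return_def by blast
  have "(x has_real_derivative (T * x \<tau> - y \<tau>)) (at \<tau>)"
    using o(1) by (simp add: is_orbit_def)
  then obtain d where d: "d > 0" "\<forall>h>0. h < d \<longrightarrow> x \<tau> < x (\<tau> - h)"
    using DERIV_neg_dec_left \<open>\<not> y1 \<le> 0\<close> o by fastforce
  obtain h where h: "0 < h" "h < min d \<tau>"
    using dense[of 0 "min d \<tau>"] d o by auto
  have "x (\<tau> - h) < 0" using o h by simp
  moreover have "x \<tau> < x (\<tau> - h)" using d h by simp
  ultimately show False using o(3) by simp
qed

lemma left_return_energy:
  assumes "left_return T D a y0 y1"
  shows "T = 0 \<Longrightarrow> y1\<^sup>2 = y0\<^sup>2" and "T \<noteq> 0 \<Longrightarrow> T * y0\<^sup>2 < T * y1\<^sup>2"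
proof -
  obtain x y \<tau> where o: "is_orbit T D a y0 x y" "\<tau> > 0" "x \<tau> = 0"
      "\<forall>t\<in>{0<..<\<tau>}. x t < 0" "y1 = y \<tau>"
    using assms unfolding left_return_def by blast
  have dx: "(x has_real_derivative (T * x s - y s)) (at s)"
    and dy: "(y has_real_derivative (D * x s - a)) (at s)" for s
    using o(1) by (simp_all add: is_orbit_def)
  define E where "E = (\<lambda>s. (T * x s - y s)\<^sup>2 + D * (x s)\<^sup>2 - 2 * a * x s)"
  have dE: "(E has_real_derivative 2 * T * (T * x s - y s)\<^sup>2) (at s)" for s
    unfolding E_def
    by (auto intro!: derivative_eq_intros dx dy simp: algebra_simps power2_eq_square)
  have ends: "E 0 = y0\<^sup>2" "E \<tau> = y1\<^sup>2"
    using o by (simp_all add: E_def is_orbit_def)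
  show "y1\<^sup>2 = y0\<^sup>2" if "T = 0"
    using DERIV_isconst_all[of E \<tau> 0] dE ends that by simp
  show "T * y0\<^sup>2 < T * y1\<^sup>2" if "T \<noteq> 0"
  proof -
    \<comment> \<open>Multiplying the energy by \<open>T\<close> turns its derivative into twice a
      square, so both signs of \<open>T\<close> are treated at once.\<close>
    have dTE: "((\<lambda>s. T * E s) has_real_derivative 2 * (T * (T * x s - y s))\<^sup>2) (at s)" for s
      by (auto intro!: derivative_eq_intros dE simp: power2_eq_square)
    have mono: "T * E r \<le> T * E s" if "r \<le> s" for r s
      using DERIV_nonneg_imp_nondecreasing[OF that, of "\<lambda>s. T * E s"] dTE
      by (meson zero_le_mult_iff zero_le_numeral zero_le_power2)
    \<comment> \<open>Strictness needs one time with \<open>x' \<noteq> 0\<close>. The mean value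
      theorem provides it, as \<open>x\<close> falls from 0 to a negative value at
      \<open>\<tau> / 2\<close>.\<close>
    obtain c where c: "0 < c" "c < \<tau> / 2"
        "x (\<tau> / 2) - x 0 = (\<tau> / 2 - 0) * (T * x c - y c)"
      using MVT2[of 0 "\<tau> / 2" x "\<lambda>s. T * x s - y s"] dx o(2) by auto
    have "x (\<tau> / 2) < 0" "x 0 = 0"
      using o by (auto simp: is_orbit_def)
    then have "T * x c - y c \<noteq> 0"
      using c(3) by auto
    then have "2 * (T * (T * x c - y c))\<^sup>2 > 0"
      using that by simp
    then obtain d where d: "d > 0" "\<forall>h>0. h < d \<longrightarrow> T * E c < T * E (c + h)"
      using DERIV_pos_inc_right[OF dTE[of c]] by blast
    \<comment> \<open>The bound \<open>\<tau> - c\<close> keeps \<open>c + h\<close> before the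
      return time, so the strict gain just after \<open>c\<close> survives up to
      \<open>\<tau>\<close> by monotonicity.\<close>
    obtain h where h: "0 < h" "h < min d (\<tau> - c)"
      using dense[of 0 "min d (\<tau> - c)"] d c by auto
    have "T * E 0 \<le> T * E c" using mono c by simp
    also have "\<dots> < T * E (c + h)" using d h by simp
    also have "\<dots> \<le> T * E \<tau>" using mono h by simp
    finally show ?thesis using ends by simp
  qed
qed

lemma left_return_sgn:
  assumes "left_return T D a y0 y1" and "y0 \<ge> 0"
  shows "sgn (y0 + y1) = - sgn T"
proof -
  have y1: "y1 \<le> 0" using assms(1) by (rule left_return_nonpos)
  consider "T = 0" | "T > 0" | "T < 0" by linarith
  then show ?thesis
  proof cases
    case 1
    \<comment> \<open>Writing the square with \<open>- y1\<close> makes both bases nonnegative, so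
      that squares can be cancelled here and in the other cases.\<close>
    then have "(- y1)\<^sup>2 = y0\<^sup>2" using left_return_energy(1)[OF assms(1)] by simp
    then have "- y1 = y0" using y1 assms(2) by (simp only: power2_eq_iff_nonneg neg_0_le_iff_le)
    then have "y0 + y1 = 0" by simp
    then show ?thesis using 1 by simp
  next
    case 2
    then have "y0\<^sup>2 < (- y1)\<^sup>2" using left_return_energy(2)[OF assms(1)] by simp
    then have "y0 < - y1" by (rule power2_less_imp_less) (use y1 in simp)
    then show ?thesis using 2 by simp
  next
    case 3
    then have "(- y1)\<^sup>2 < y0\<^sup>2" using left_return_energy(2)[OF assms(1)] by simp
    then have "- y1 < y0" using assms(2) by (rule power2_less_imp_less)
    then show ?thesis using 3 by simp
  qed
qed

text \<open>Uniqueness of the return value lets the description operator in \<open>half_map\<close>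
  be evaluated.\<close>

lemma half_map_eq:
  assumes "left_return T D a y0 y1"
  shows "half_map T D a y0 = y1"
  unfolding half_map_def using assms left_return_unique by (auto intro!: the_equality)

theorem proposition5:
  fixes T D a :: real
  assumes "a^2 + D^2 \<noteq> 0"
  shows "(\<forall>y0 \<in> half_map_domain T D a - {0}.
            sgn (y0 + half_map T D a y0) = - sgn T) \<and>
         (0 \<in> half_map_domain T D a \<and> (half_map T D a 0 \<noteq> 0 \<or> T = 0) \<longrightarrow>
            sgn (0 + half_map T D a 0) = - sgn T)"
proof -
  have ret: "sgn (y0 + half_map T D a y0) = - sgn T"
    if "left_return T D a y0 y1" "y0 \<ge> 0" for y0 y1
    using left_return_sgn[OF that] half_map_eq[OF that(1)] by simp
  \<comment> \<open>If the orbit through the origin does not return, the default value 0 applies.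
    Then \<open>half_map T D a 0 \<noteq> 0\<close> is impossible, and for \<open>T = 0\<close> both
    sides of the claim vanish.\<close>
  have "half_map T D a 0 = 0" if "\<nexists>y1. left_return T D a 0 y1"
    using that by (simp add: half_map_def)
  then show ?thesis
    using ret by (force simp: half_map_domain_def)
qed

end
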